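(* Let $f : \mathbb{C} \to \mathbb{C}$ be an entire function. Let $\mathcal{G} \subseteq \mathbb{C}$ be a domain such that $s \in \mathcal{G}$ implies $s - 1 \in \mathcal{G}$. Suppose $u : \mathcal{G} \to \mathbb{C}$ is holomorphic and that for every compact set $\mathcal{S} \subset \mathcal{G}$, $$\sum_{j=1}^\infty \sup_{s \in \mathcal{S}} |u(s-j)| < \infty.$$ Then there exists a holomorphic function $F : \mathcal{G} \to \mathbb{C}$ such that $$F(s+1) = u(s)\, f(F(s))$$ for all $s \in \mathcal{G}$ with $s+1 \in \mathcal{G}$. Moreover, $F$ is given by the infinite composition $$F(s) = \lim_{n\to\infty} u(s-1) f\Big(u(s-2) f\big(\cdots u(s-n) f(z)\cdots\big)\Big),$$ where the limit exists for every $s \in \mathcal{G}$ and $z \in \mathbb{C}$ and its value does not depend on $z$.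
   Context: A domain is a nonempty connected open subset of $\mathbb{C}$. The infinite composition is the limit of finite compositions: for fixed $s \in \mathcal{G}$ put $h_j(z) = u(s-j) f(z)$ for $z \in \mathbb{C}$ and $j \ge 1$; then $F(s) = \lim_{n\to\infty} h_1(h_2(\cdots h_n(z)\cdots))$, the limit being constant in $z$. *)

theory Defs
  imports "HOL-Complex_Analysis.Complex_Analysis"
begin

definition complex_domain :: "complex set \<Rightarrow> bool" where
  "complex_domain G \<longleftrightarrow> open G \<and> connected G \<and> G \<noteq> {}"

definition comp_step :: "(complex \<Rightarrow> complex) \<Rightarrow> (complex \<Rightarrow> complex) \<Rightarrow> complex \<Rightarrow> nat \<Rightarrow> complex \<Rightarrow> complex" where
  "comp_step u f s j z = u (s - of_nat j) * f z"

text \<open>With \<open>h\<^sub>j = comp_step u f s j\<close>, the value of \<open>fin_comp u f s n z\<close> is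
  \<open>h\<^sub>1 (h\<^sub>2 (\<dots> (h\<^sub>n z)))\<close>: \<open>foldr\<close> puts the last index innermost.\<close>

definition fin_comp :: "(complex \<Rightarrow> complex) \<Rightarrow> (complex \<Rightarrow> complex) \<Rightarrow> complex \<Rightarrow> nat \<Rightarrow> complex \<Rightarrow> complex" where
  "fin_comp u f s n z = foldr (comp_step u f s) [1..<Suc n] z"

text \<open>The sum over \<open>j \<ge> 1\<close> of the suprema of \<open>|u (s - j)|\<close> over each compact subset of \<open>G\<close> is finite.
  The empty compact set is excluded because \<open>Sup {}\<close> is unspecified on the reals. When \<open>u\<close> is
  continuous on \<open>G\<close> and \<open>G\<close> is closed under \<open>s \<mapsto> s - 1\<close>, all the other suprema are over nonempty
  bounded sets, so they are the true ones.\<close>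

definition compactly_summable_shifts :: "complex set \<Rightarrow> (complex \<Rightarrow> complex) \<Rightarrow> bool" where
  "compactly_summable_shifts G u \<longleftrightarrow>
     (\<forall>S. compact S \<and> S \<noteq> {} \<and> S \<subseteq> G \<longrightarrow>
        summable (\<lambda>j. SUP s\<in>S. cmod (u (s - of_nat (Suc j)))))"

end

theory Submission
  imports Defs
begin

text \<open>Near a point of \<open>G\<close> the shifts \<open>u (s - j)\<close> tend to \<open>0\<close> uniformly as \<open>j\<close> grows, so for a suitable
  \<open>N\<close> every map \<open>w \<mapsto> u (s - j) f w\<close> with \<open>j > N\<close> is a \<open>1/2\<close>-contraction of a given disc into
  itself. Hence the inner compositions \<open>h\<^sub>N\<^sub>+\<^sub>1 \<circ> \<dots> \<circ> h\<^sub>n\<close> converge geometrically, uniformly in \<open>s\<close> and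
  in the starting point, to a holomorphic function of \<open>s\<close>. Applying the fixed finite composition
  \<open>h\<^sub>1 \<circ> \<dots> \<circ> h\<^sub>N\<close> preserves pointwise convergence and the holomorphy of the limit.\<close>

section \<open>Finite compositions: splitting and holomorphy\<close>

lemma fin_comp_0 [simp]: "fin_comp u f s 0 z = z"
  by (simp add: fin_comp_def)

lemma fin_comp_Suc: "fin_comp u f s (Suc n) z = fin_comp u f s n (u (s - of_nat (Suc n)) * f z)"
  by (simp add: fin_comp_def comp_step_def)

text \<open>The factor in step \<open>j\<close> depends only on \<open>s - j\<close>, so the steps
  \<open>N + 1\<close> to \<open>N + m\<close> at \<open>s\<close> are the steps \<open>1\<close> to
  \<open>m\<close> at \<open>s - N\<close>. A tail is thus again a composition of the same kind, at
  a shifted point.\<close>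

lemma fin_comp_add:
  "fin_comp u f s (N + m) z = fin_comp u f s N (fin_comp u f (s - of_nat N) m z)"
  by (induction m arbitrary: z) (simp_all add: fin_comp_Suc algebra_simps)

text \<open>The starting point is a function \<open>T\<close> of \<open>s\<close> because the
  induction absorbs the innermost map into it. This form also allows the limit of a tail to be
  inserted later.\<close>

lemma holomorphic_on_fin_comp:
  assumes "f holomorphic_on UNIV" "T holomorphic_on A"
    and "\<And>j. j \<ge> 1 \<Longrightarrow> (\<lambda>s. u (s - of_nat j)) holomorphic_on A"
  shows "(\<lambda>s. fin_comp u f s n (T s)) holomorphic_on A"
  using assms(2)
proof (induction n arbitrary: T)
  case (Suc n)
  have "(\<lambda>s. f (T s)) holomorphic_on A"
    using holomorphic_on_compose_gen[OF Suc.prems assms(1)] by (simp add: o_def)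
  then have "(\<lambda>s. u (s - of_nat (Suc n)) * f (T s)) holomorphic_on A"
    by (intro holomorphic_on_mult assms(3)) auto
  then show ?case
    unfolding fin_comp_Suc by (rule Suc.IH)
qed simp

lemma holomorphic_on_minus_of_nat:
  assumes "u holomorphic_on G" "\<And>s. s \<in> A \<Longrightarrow> s - of_nat j \<in> G"
  shows "(\<lambda>s. u (s - of_nat j)) holomorphic_on A"
proof -
  have "(\<lambda>s. s - of_nat j) ` A \<subseteq> G" using assms(2) by blast
  moreover have "(\<lambda>s::complex. s - of_nat j) holomorphic_on A" by (intro holomorphic_intros)
  ultimately show ?thesis
    using holomorphic_on_compose_gen[OF _ assms(1)] by (fastforce simp: o_def)
qed

section \<open>Estimates on a disc and contraction\<close>

lemma entire_bounded_lipschitz_on_cball: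
  fixes f :: "complex \<Rightarrow> complex"
  assumes "f holomorphic_on UNIV"
  obtains B where "B > 0" "\<And>z. z \<in> cball 0 R \<Longrightarrow> cmod (f z) \<le> B"
    "\<And>z w. z \<in> cball 0 R \<Longrightarrow> w \<in> cball 0 R \<Longrightarrow> cmod (f z - f w) \<le> B * cmod (z - w)"
proof -
  have "continuous_on (cball 0 R) f"
    using assms holomorphic_on_imp_continuous_on holomorphic_on_subset by blast
  then have "bounded (f ` cball 0 R)"
    by (intro compact_imp_bounded compact_continuous_image) auto
  then obtain B1 where B1: "B1 > 0" "\<And>z. z \<in> cball 0 R \<Longrightarrow> cmod (f z) \<le> B1"
    unfolding bounded_pos by blast
  have "deriv f holomorphic_on UNIV" using assms by (intro holomorphic_deriv) auto
  then have "continuous_on (cball 0 R) (deriv f)"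
    using holomorphic_on_imp_continuous_on holomorphic_on_subset by blast
  then have "bounded (deriv f ` cball 0 R)"
    by (intro compact_imp_bounded compact_continuous_image) auto
  then obtain B2 where B2: "B2 > 0" "\<And>z. z \<in> cball 0 R \<Longrightarrow> cmod (deriv f z) \<le> B2"
    unfolding bounded_pos by blast
  have lip: "cmod (f z - f w) \<le> B2 * cmod (z - w)" if "z \<in> cball 0 R" "w \<in> cball 0 R" for z w
  proof (rule field_differentiable_bound[OF convex_cball[of 0 R] _ B2(2) that])
    show "(f has_field_derivative deriv f z) (at z within cball 0 R)" for z
      using holomorphic_derivI[OF assms open_UNIV] by auto
  qed auto
  \<comment> \<open>Taking the maximum gives one constant that serves as bound and as Lipschitz
    constant, so that a single product \<open>c * B\<close> controls both later.\<close>
  show thesis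
  proof (rule that[of "max B1 B2"])
    fix z w :: complex assume zw: "z \<in> cball 0 R" "w \<in> cball 0 R"
    have "B2 * cmod (z - w) \<le> max B1 B2 * cmod (z - w)" by (intro mult_right_mono) auto
    then show "cmod (f z - f w) \<le> max B1 B2 * cmod (z - w)" using lip[OF zw] by linarith
  next
    show "cmod (f z) \<le> max B1 B2" if "z \<in> cball 0 R" for z
      using B1(2)[OF that] by simp
  qed (use B1(1) in simp)
qed

text \<open>Here \<open>c\<close> is meant to bound the factors \<open>u (s - j)\<close>. The
  condition \<open>c * B \<le> R\<close> keeps each step inside the disc, and
  \<open>c * B \<le> 1 / 2\<close> makes it halve distances there.\<close>

locale contracting_shifts =
  fixes u f :: "complex \<Rightarrow> complex" and R c B :: real
  assumes bound: "\<And>z. z \<in> cball 0 R \<Longrightarrow> cmod (f z) \<le> B"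
    and lipschitz: "\<And>z w. z \<in> cball 0 R \<Longrightarrow> w \<in> cball 0 R \<Longrightarrow> cmod (f z - f w) \<le> B * cmod (z - w)"
    and into: "c * B \<le> R" and half: "c * B \<le> 1 / 2"
begin

lemma step_in_cball:
  assumes "cmod a \<le> c" "z \<in> cball 0 R"
  shows "a * f z \<in> cball 0 R"
proof -
  \<comment> \<open>Monotonicity of the product requires \<open>0 \<le> c\<close>, which follows
    from \<open>0 \<le> cmod a \<le> c\<close>.\<close>
  have "cmod (a * f z) \<le> c * B"
    unfolding norm_mult using assms bound[OF assms(2)]
    by (intro mult_mono) (auto intro: order_trans[OF norm_ge_zero])
  then show ?thesis using into by simp
qed

lemma step_contracts:
  assumes "cmod a \<le> c" "z \<in> cball 0 R" "w \<in> cball 0 R"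
  shows "cmod (a * f z - a * f w) \<le> 1 / 2 * cmod (z - w)"
proof -
  have "cmod (a * f z - a * f w) = cmod a * cmod (f z - f w)"
    by (simp add: norm_mult flip: right_diff_distrib)
  also have "\<dots> \<le> c * (B * cmod (z - w))"
    using assms lipschitz[OF assms(2,3)]
    by (intro mult_mono) (auto intro: order_trans[OF norm_ge_zero])
  also have "\<dots> = (c * B) * cmod (z - w)" by simp
  also have "\<dots> \<le> 1 / 2 * cmod (z - w)" using half by (intro mult_right_mono) auto
  finally show ?thesis .
qed

lemma fin_comp_in_cball:
  assumes "\<And>j. j \<ge> 1 \<Longrightarrow> cmod (u (s - of_nat j)) \<le> c" "z \<in> cball 0 R"
  shows "fin_comp u f s m z \<in> cball 0 R"
  using assms(2)
proof (induction m arbitrary: z)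
  case (Suc m)
  show ?case unfolding fin_comp_Suc
    by (intro Suc.IH step_in_cball assms(1) Suc.prems) auto
qed simp

lemma fin_comp_contracts:
  assumes small: "\<And>j. j \<ge> 1 \<Longrightarrow> cmod (u (s - of_nat j)) \<le> c"
    and "z \<in> cball 0 R" "w \<in> cball 0 R"
  shows "cmod (fin_comp u f s m z - fin_comp u f s m w) \<le> (1 / 2) ^ m * cmod (z - w)"
  using assms(2,3)
proof (induction m arbitrary: z w)
  case (Suc m)
  let ?a = "u (s - of_nat (Suc m))"
  have a: "cmod ?a \<le> c" by (rule small) simp
  have "cmod (fin_comp u f s (Suc m) z - fin_comp u f s (Suc m) w)
      \<le> (1 / 2) ^ m * cmod (?a * f z - ?a * f w)"
    unfolding fin_comp_Suc by (intro Suc.IH step_in_cball a Suc.prems)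
  also have "\<dots> \<le> (1 / 2) ^ m * (1 / 2 * cmod (z - w))"
    by (intro mult_left_mono step_contracts a Suc.prems) auto
  finally show ?case by simp
qed simp

text \<open>The longer composition is the shorter one started at the value \<open>v\<close> of the
  remaining inner maps. Both starting points lie in the disc, hence at distance at most
  \<open>2 * R\<close>, and \<open>m\<close> maps halve it \<open>m\<close> times. Letting
  \<open>z\<close> and \<open>w\<close> differ covers both the Cauchy property and the independence
  of the starting point.\<close>

lemma fin_comp_dist_le:
  assumes small: "\<And>j. j \<ge> 1 \<Longrightarrow> cmod (u (s - of_nat j)) \<le> c"
    and "z \<in> cball 0 R" "w \<in> cball 0 R" "m \<le> n"
  shows "dist (fin_comp u f s m z) (fin_comp u f s n w) \<le> (1 / 2) ^ m * (2 * R)"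
proof -
  define v where "v = fin_comp u f (s - of_nat m) (n - m) w"
  have "cmod (u (s - of_nat m - of_nat j)) \<le> c" if "j \<ge> 1" for j
    using small[of "m + j"] that by (simp add: algebra_simps)
  then have v: "v \<in> cball 0 R" unfolding v_def by (intro fin_comp_in_cball assms)
  have "fin_comp u f s n w = fin_comp u f s m v"
    using fin_comp_add[of u f s m "n - m" w] \<open>m \<le> n\<close> by (simp add: v_def)
  then have "dist (fin_comp u f s m z) (fin_comp u f s n w) \<le> (1 / 2) ^ m * cmod (z - v)"
    using fin_comp_contracts[OF small assms(2) v] by (simp add: dist_norm)
  also have "\<dots> \<le> (1 / 2) ^ m * (2 * R)"
    using norm_triangle_ineq4[of z v] v assms(2) by (intro mult_left_mono) auto
  finally show ?thesis .
qed

end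

section \<open>Uniform smallness of the shifts\<close>

lemma minus_of_nat_mem:
  fixes G :: "complex set"
  assumes "\<forall>s\<in>G. s - 1 \<in> G" "s \<in> G"
  shows "s - of_nat j \<in> G"
proof (induction j)
  case (Suc j)
  then have "s - of_nat j - 1 \<in> G" using assms(1) by blast
  then show ?case by (simp add: algebra_simps)
qed (use assms in simp)

lemma compactly_summable_shifts_eventually_small:
  assumes "compactly_summable_shifts G u" "u holomorphic_on G"
    and "\<forall>s\<in>G. s - 1 \<in> G"
    and S: "compact S" "S \<noteq> {}" "S \<subseteq> G" and "c > 0"
  obtains N :: nat where "\<And>s j. s \<in> S \<Longrightarrow> j > N \<Longrightarrow> cmod (u (s - of_nat j)) \<le> c"
proof -
  let ?M = "\<lambda>j. SUP s\<in>S. cmod (u (s - of_nat (Suc j)))"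
  have "summable ?M" using assms unfolding compactly_summable_shifts_def by blast
  then have "?M \<longlonglongrightarrow> 0" by (rule summable_LIMSEQ_zero)
  then have "eventually (\<lambda>j. ?M j < c) sequentially" using \<open>c > 0\<close> by (rule order_tendstoD)
  then obtain N where N: "\<And>j. j \<ge> N \<Longrightarrow> ?M j < c" unfolding eventually_sequentially by blast
  show thesis
  proof (rule that[of N])
    fix s j assume "s \<in> S" "N < j"
    \<comment> \<open>The summand with index \<open>i\<close> belongs to the shift by
      \<open>Suc i\<close>.\<close>
    then obtain i where i: "j = Suc i" "i \<ge> N" by (cases j) auto
    \<comment> \<open>The supremum dominates the values once they are bounded above, which comes
      from continuity on the compact set \<open>S\<close>.\<close>
    have "(\<lambda>s. u (s - of_nat (Suc i))) holomorphic_on S"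
      using assms(2) minus_of_nat_mem[OF assms(3)] S(3)
      by (intro holomorphic_on_minus_of_nat) blast+
    then have "continuous_on S (\<lambda>s. cmod (u (s - of_nat (Suc i))))"
      by (intro continuous_on_norm holomorphic_on_imp_continuous_on)
    then have "bdd_above ((\<lambda>s. cmod (u (s - of_nat (Suc i)))) ` S)"
      using S(1) by (intro bounded_imp_bdd_above compact_imp_bounded compact_continuous_image)
    then have "cmod (u (s - of_nat (Suc i))) \<le> ?M i"
      using \<open>s \<in> S\<close> by (rule cSUP_upper2) simp
    then show "cmod (u (s - of_nat j)) \<le> c" using N[OF i(2)] i(1) by simp
  qed
qed

section \<open>Local convergence to a holomorphic limit\<close>

lemma fin_comp_locally_convergent:
  assumes f: "f holomorphic_on UNIV" and "open G"
    and shift: "\<forall>s\<in>G. s - 1 \<in> G"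
    and u: "u holomorphic_on G" and "compactly_summable_shifts G u"
    and "s0 \<in> G" "R \<ge> 1"
  obtains r \<Phi> where "r > 0" "ball s0 r \<subseteq> G" "\<Phi> holomorphic_on ball s0 r"
    "\<And>s z. s \<in> ball s0 r \<Longrightarrow> z \<in> cball 0 R \<Longrightarrow> (\<lambda>n. fin_comp u f s n z) \<longlonglongrightarrow> \<Phi> s"
proof -
  obtain r where r: "r > 0" "cball s0 r \<subseteq> G"
    using \<open>open G\<close> \<open>s0 \<in> G\<close> open_contains_cball by blast
  then have ballG: "ball s0 r \<subseteq> G" using ball_subset_cball by blast
  obtain B where B: "B > 0" "\<And>z. z \<in> cball 0 R \<Longrightarrow> cmod (f z) \<le> B"
    "\<And>z w. z \<in> cball 0 R \<Longrightarrow> w \<in> cball 0 R \<Longrightarrow> cmod (f z - f w) \<le> B * cmod (z - w)"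
    using entire_bounded_lipschitz_on_cball[OF f, of R] by metis
  \<comment> \<open>This choice gives \<open>c * B = 1 / 2\<close>, which is also at most
    \<open>R\<close> because \<open>R \<ge> 1\<close>.\<close>
  define c where "c = 1 / (2 * B)"
  have c: "c > 0" "c * B = 1 / 2" using B(1) by (auto simp: c_def)
  interpret contracting_shifts u f R c B
    by standard (use B c \<open>R \<ge> 1\<close> in auto)
  have "cball s0 r \<noteq> {}" using r by auto
  then obtain N :: nat where N: "\<And>s j. s \<in> cball s0 r \<Longrightarrow> j > N \<Longrightarrow> cmod (u (s - of_nat j)) \<le> c"
    using compactly_summable_shifts_eventually_small[OF assms(5) u shift compact_cball _ r(2) c(1)]
    by blast
  have small: "cmod (u (s - of_nat N - of_nat j)) \<le> c" if "s \<in> ball s0 r" "j \<ge> 1" for s j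
    using N[of s "N + j"] that by (simp add: algebra_simps)
  have shift_ball: "s - of_nat j \<in> G" if "s \<in> ball s0 r" for s j
    using minus_of_nat_mem[OF shift] ballG that by blast
  \<comment> \<open>\<open>T m s\<close> is the tail made of the steps \<open>N + 1\<close> to
    \<open>N + m\<close>, started at the centre of the disc.\<close>
  define T where "T m s = fin_comp u f (s - of_nat N) m 0" for m s
  have "uniformly_Cauchy_on (ball s0 r) T"
    unfolding uniformly_Cauchy_on_def
  proof (intro allI impI)
    fix e :: real assume "e > 0"
    have "(\<lambda>m. (1 / 2) ^ m * (2 * R)) \<longlonglongrightarrow> 0" by (intro tendsto_eq_intros LIMSEQ_power_zero) auto
    then have "eventually (\<lambda>m. (1 / 2) ^ m * (2 * R) < e) sequentially"
      using \<open>e > 0\<close> by (rule order_tendstoD)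
    then obtain M where M: "\<And>m. m \<ge> M \<Longrightarrow> (1 / 2) ^ m * (2 * R) < e"
      unfolding eventually_sequentially by blast
    have le: "dist (T m s) (T n s) < e" if "s \<in> ball s0 r" "m \<ge> M" "m \<le> n" for s m n
    proof -
      have "dist (T m s) (T n s) \<le> (1 / 2) ^ m * (2 * R)"
        unfolding T_def by (rule fin_comp_dist_le[OF small]) (use that \<open>R \<ge> 1\<close> in auto)
      then show ?thesis using M[OF that(2)] by linarith
    qed
    have "dist (T m s) (T n s) < e" if s: "s \<in> ball s0 r" and mn: "m \<ge> M" "n \<ge> M" for s m n
    proof (cases "m \<le> n")
      case True
      then show ?thesis by (rule le[OF s mn(1)])
    next
      case False
      then have "n \<le> m" by simp
      then show ?thesis using le[OF s mn(2)] by (simp add: dist_commute)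
    qed
    then show "\<exists>M. \<forall>x\<in>ball s0 r. \<forall>m\<ge>M. \<forall>n\<ge>M. dist (T m x) (T n x) < e" by blast
  qed
  then obtain L where L: "uniform_limit (ball s0 r) T L sequentially"
    using Cauchy_uniformly_convergent uniformly_convergent_on_def by blast
  have hol: "(\<lambda>s. u (s - of_nat j)) holomorphic_on ball s0 r" for j
    using u shift_ball by (rule holomorphic_on_minus_of_nat)
  have T_hol: "T m holomorphic_on ball s0 r" for m
  proof -
    \<comment> \<open>Holomorphy is shown in the variable \<open>w = s - N\<close> on the translated
      ball, then pulled back along the translation.\<close>
    have "(\<lambda>w. fin_comp u f w m 0) holomorphic_on (\<lambda>s. s - of_nat N) ` ball s0 r"
    proof (rule holomorphic_on_fin_comp[OF f, of "\<lambda>_. 0"])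
      fix j :: nat
      show "(\<lambda>s. u (s - of_nat j)) holomorphic_on (\<lambda>s. s - of_nat N) ` ball s0 r"
        using minus_of_nat_mem[OF shift] shift_ball
        by (intro holomorphic_on_minus_of_nat[OF u]) blast
    qed auto
    then have "((\<lambda>w. fin_comp u f w m 0) \<circ> (\<lambda>s. s - of_nat N)) holomorphic_on ball s0 r"
      by (intro holomorphic_on_compose) (intro holomorphic_intros)
    then show ?thesis by (simp add: T_def[abs_def] o_def)
  qed
  have L_hol: "L holomorphic_on ball s0 r"
  proof (rule holomorphic_uniform_sequence[OF open_ball T_hol])
    fix x assume "x \<in> ball s0 r"
    then obtain d where "d > 0" "cball x d \<subseteq> ball s0 r" using open_ball open_contains_cball by blast
    then show "\<exists>d>0. cball x d \<subseteq> ball s0 r \<and> uniform_limit (cball x d) T L sequentially"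
      using L uniform_limit_on_subset by blast
  qed
  \<comment> \<open>Tails of equal length started at \<open>0\<close> and at \<open>z\<close> differ
    by at most \<open>(1 / 2) ^ m * (2 * R)\<close>, so they share the limit.\<close>
  have L_lim: "(\<lambda>m. fin_comp u f (s - of_nat N) m z) \<longlonglongrightarrow> L s"
    if "s \<in> ball s0 r" "z \<in> cball 0 R" for s z
  proof (rule Lim_transform2)
    show "(\<lambda>m. T m s) \<longlonglongrightarrow> L s" using L that(1) by (rule tendsto_uniform_limitI)
    have lim: "(\<lambda>m. (1 / 2) ^ m * (2 * R)) \<longlonglongrightarrow> 0" by (intro tendsto_eq_intros LIMSEQ_power_zero) auto
    show "(\<lambda>m. T m s - fin_comp u f (s - of_nat N) m z) \<longlonglongrightarrow> 0"
    proof (rule Lim_null_comparison[OF always_eventually lim], intro allI)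
      fix m
      show "norm (T m s - fin_comp u f (s - of_nat N) m z) \<le> (1 / 2) ^ m * (2 * R)"
        unfolding T_def dist_norm[symmetric]
        by (rule fin_comp_dist_le[OF small]) (use that \<open>R \<ge> 1\<close> in auto)
    qed
  qed
  \<comment> \<open>The local limit is the first \<open>N\<close> maps applied to
    \<open>L s\<close>. These maps may fail to contract, but their continuity suffices to pass to
    the limit.\<close>
  show thesis
  proof (rule that[OF r(1) ballG])
    show "(\<lambda>s. fin_comp u f s N (L s)) holomorphic_on ball s0 r"
      by (rule holomorphic_on_fin_comp[OF f L_hol hol])
    fix s z assume sz: "s \<in> ball s0 r" "z \<in> cball (0::complex) R"
    have "isCont (fin_comp u f s N) w" for w
    proof (induction N arbitrary: w)
      case 0
      have "fin_comp u f s 0 = (\<lambda>z. z)" by (rule ext) simp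
      then show ?case by simp
    next
      case (Suc N)
      have "isCont f w"
        using holomorphic_on_imp_continuous_on[OF f] by (simp add: continuous_on_eq_continuous_at)
      then have "isCont (\<lambda>z. u (s - of_nat (Suc N)) * f z) w" by (intro continuous_intros)
      from isCont_o2[OF this Suc.IH] show ?case by (simp add: fin_comp_Suc)
    qed
    then have "(\<lambda>m. fin_comp u f s N (fin_comp u f (s - of_nat N) m z)) \<longlonglongrightarrow> fin_comp u f s N (L s)"
      using L_lim[OF sz] by (rule isCont_tendsto_compose)
    then have "(\<lambda>m. fin_comp u f s (m + N) z) \<longlonglongrightarrow> fin_comp u f s N (L s)"
      by (simp add: add.commute[of _ N] fin_comp_add)
    then show "(\<lambda>n. fin_comp u f s n z) \<longlonglongrightarrow> fin_comp u f s N (L s)" by (rule LIMSEQ_offset)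
  qed
qed

section \<open>Gluing the local limits and the functional equation\<close>

theorem theorem3p1:
  fixes f u :: "complex \<Rightarrow> complex" and G :: "complex set"
  assumes "f holomorphic_on UNIV"
    and "complex_domain G"
    and "\<And>s. s \<in> G \<Longrightarrow> s - 1 \<in> G"
    and "u holomorphic_on G"
    and "compactly_summable_shifts G u"
  shows "\<exists>F. F holomorphic_on G \<and>
           (\<forall>s\<in>G. s + 1 \<in> G \<longrightarrow> F (s + 1) = u s * f (F s)) \<and>
           (\<forall>s\<in>G. \<forall>z. (\<lambda>n. fin_comp u f s n z) \<longlonglongrightarrow> F s)"
proof -
  have G: "open G" using assms(2) by (simp add: complex_domain_def)
  have "\<forall>s\<in>G. s - 1 \<in> G" using assms(3) by blast
  note local = fin_comp_locally_convergent[OF assms(1) G this assms(4,5)]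
  define F where "F s = lim (\<lambda>n. fin_comp u f s n 0)" for s
  have lim: "(\<lambda>n. fin_comp u f s n z) \<longlonglongrightarrow> F s" if s: "s \<in> G" for s z
  proof -
    \<comment> \<open>The radius is chosen so that the disc contains both \<open>0\<close> and
      \<open>z\<close>; both sequences then tend to the same \<open>\<Phi> s\<close>.\<close>
    obtain r \<Phi> where *: "r > 0"
      "\<And>s' w. s' \<in> ball s r \<Longrightarrow> w \<in> cball 0 (max 1 (cmod z)) \<Longrightarrow> (\<lambda>n. fin_comp u f s' n w) \<longlonglongrightarrow> \<Phi> s'"
      using local[OF s, of "max 1 (cmod z)"] by (metis max.cobounded1)
    have "(\<lambda>n. fin_comp u f s n 0) \<longlonglongrightarrow> \<Phi> s" using *(1) by (intro *(2)) auto
    then have "F s = \<Phi> s" unfolding F_def by (rule limI)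
    then show ?thesis using *(1) *(2)[of s z] by simp
  qed
  have "F holomorphic_on G"
    unfolding holomorphic_on_def
  proof
    fix s assume s: "s \<in> G"
    obtain r \<Phi> where *: "r > 0" "ball s r \<subseteq> G" "\<Phi> holomorphic_on ball s r"
      "\<And>s' w. s' \<in> ball s r \<Longrightarrow> w \<in> cball 0 1 \<Longrightarrow> (\<lambda>n. fin_comp u f s' n w) \<longlonglongrightarrow> \<Phi> s'"
      using local[OF s, of 1] by (metis order_refl)
    \<comment> \<open>\<open>F\<close> is defined from the starting point \<open>0\<close>, so the
      unit disc suffices to identify it with \<open>\<Phi>\<close> on the whole ball.\<close>
    have "\<Phi> x = F x" if "x \<in> ball s r" for x
      using *(4)[OF that, of 0] unfolding F_def by (intro limI[symmetric]) auto
    then have "F holomorphic_on ball s r" by (rule holomorphic_transform[OF *(3)])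
    then show "F field_differentiable at s within G"
      using holomorphic_on_imp_differentiable_at[OF _ open_ball, of F s r s] *(1)
      by (simp add: field_differentiable_at_within)
  qed
  moreover have "F (s + 1) = u s * f (F s)" if "s \<in> G" "s + 1 \<in> G" for s
  proof (rule LIMSEQ_unique)
    show "(\<lambda>n. fin_comp u f (s + 1) (Suc n) 0) \<longlonglongrightarrow> F (s + 1)"
      using lim[OF that(2)] by (rule LIMSEQ_Suc)
    have "isCont f (F s)"
      using holomorphic_on_imp_continuous_on[OF assms(1)]
      by (simp add: continuous_on_eq_continuous_at)
    then have "(\<lambda>n. u s * f (fin_comp u f s n 0)) \<longlonglongrightarrow> u s * f (F s)"
      using lim[OF that(1)] by (intro tendsto_mult tendsto_const) (rule isCont_tendsto_compose)
    \<comment> \<open>Splitting off the outermost map at \<open>s + 1\<close> leaves the factor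
      \<open>u s\<close> in front and the \<open>n\<close>-step composition at \<open>s\<close>
      inside.\<close>
    moreover have "fin_comp u f (s + 1) (Suc n) 0 = u s * f (fin_comp u f s n 0)" for n
      using fin_comp_add[of u f "s + 1" 1 n 0] by (simp add: fin_comp_Suc)
    ultimately show "(\<lambda>n. fin_comp u f (s + 1) (Suc n) 0) \<longlonglongrightarrow> u s * f (F s)" by simp
  qed
  ultimately show ?thesis using lim by blast
qed

end
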